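(* Let $G\in\varepsilon_{01}$ and let $C,C'$ be two cycles of $G$ whose intersection is a path $P_t$ with $t>0$ edges. If both $C,C'$ are of type $0$, or one is of type $0$ and the other of type $1$, then $t$ is even. If both are of type $1$, then $t$ is odd.
   Context: All graphs are finite, simple and connected. An Euler graph is a connected graph all of whose nodes have even degree. A cycle of length $n$ is of type $i$ if $n\equiv i\pmod 4$. $\varepsilon_{01}$ is the class of Euler graphs in which every cycle has length $\equiv 0$ or $\equiv 1\pmod 4$ and which contain at least one cycle of each of the types $0$ and $1$. *)

theory Defs
  imports "Graph_Theory.Graph_Theory" "HOL-Number_Theory.Cong"
begin

text \<open>
  A finite simple graph is a \<^const>\<open>pair_graph\<close>: each edge is represented by its two
  orientations, so the degree of a node is the number of arcs leaving it. Cycles, paths and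
  their intersections are subgraphs in the same representation.
\<close>

definition walk_graph :: "'a \<Rightarrow> ('a \<times> 'a) awalk \<Rightarrow> 'a pair_pre_digraph" where
  "walk_graph u p = \<lparr> pverts = set (pawalk_verts u p), parcs = set p \<union> (set p)\<inverse> \<rparr>"

text \<open>
  The library's cycles include the closed walks that run along an edge and back; requiring
  length at least 3 leaves exactly the cycles of the undirected graph.
\<close>

definition cycle_subgraph :: "'a pair_pre_digraph \<Rightarrow> nat \<Rightarrow> 'a pair_pre_digraph \<Rightarrow> bool" where
  "cycle_subgraph G n C \<longleftrightarrow>
     (\<exists>u p. pre_digraph.awalk (with_proj G) u p u \<and> pre_digraph.cycle (with_proj G) p \<and>
            length p = n \<and> 3 \<le> n \<and> C = walk_graph u p)"

definition path_subgraph :: "'a pair_pre_digraph \<Rightarrow> nat \<Rightarrow> 'a pair_pre_digraph \<Rightarrow> bool" where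
  "path_subgraph G t P \<longleftrightarrow>
     (\<exists>u p v. pre_digraph.apath (with_proj G) u p v \<and> length p = t \<and> P = walk_graph u p)"

definition graph_inter ::
    "'a pair_pre_digraph \<Rightarrow> 'a pair_pre_digraph \<Rightarrow> 'a pair_pre_digraph" where
  "graph_inter H K = \<lparr> pverts = pverts H \<inter> pverts K, parcs = parcs H \<inter> parcs K \<rparr>"

definition cycle_of_type :: "'a pair_pre_digraph \<Rightarrow> nat \<Rightarrow> 'a pair_pre_digraph \<Rightarrow> bool" where
  "cycle_of_type G i C \<longleftrightarrow> (\<exists>n. cycle_subgraph G n C \<and> [n = i] (mod 4))"

definition euler_graph :: "'a pair_pre_digraph \<Rightarrow> bool" where
  "euler_graph G \<longleftrightarrow>
     pair_graph G \<and> Digraph_Component.connected (with_proj G) \<and>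
     (\<forall>v \<in> pverts G. even (out_degree (with_proj G) v))"

definition euler01 :: "'a pair_pre_digraph set" where
  "euler01 = {G. euler_graph G \<and>
     (\<forall>n C. cycle_subgraph G n C \<longrightarrow> [n = 0] (mod 4) \<or> [n = 1] (mod 4)) \<and>
     (\<exists>C. cycle_of_type G 0 C) \<and> (\<exists>C. cycle_of_type G 1 C)}"

lemma pawalk_verts_eq: "pcas u p v \<Longrightarrow> pawalk_verts u p = u # map snd p"
  by (induction p arbitrary: u) auto

lemma pcas_last: "pcas u p v \<Longrightarrow> p \<noteq> [] \<Longrightarrow> snd (last p) = v"
  by (induction p arbitrary: u) (auto split: if_splits)

text \<open>The length, and hence the type, of a cycle depends only on the subgraph.\<close>

lemma cycle_subgraph_card:
  assumes "cycle_subgraph G n C"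
  shows "card (pverts C) = n"
proof -
  obtain u p where w: "pcas u p u" and cyc: "pre_digraph.cycle (with_proj G) p"
    and n: "length p = n" "3 \<le> n" and C: "C = walk_graph u p"
    using assms by (auto simp: cycle_subgraph_def pre_digraph.awalk_def cas_with_proj_eq)
  obtain u' where "pcas u' p u'" "distinct (tl (pawalk_verts u' p))"
    using cyc by (auto simp: pre_digraph.cycle_def pre_digraph.awalk_def cas_with_proj_eq
        awalk_verts_with_proj_eq)
  then have "distinct (map snd p)" by (simp add: pawalk_verts_eq)
  moreover have "p \<noteq> []" using n by auto
  then have "u \<in> set (map snd p)" using pcas_last[OF w] last_in_set[of p] by force
  then have "pverts C = set (map snd p)"
    using pawalk_verts_eq[OF w] by (auto simp: C walk_graph_def)
  ultimately show ?thesis using n distinct_card[of "map snd p"] by simp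
qed

end

theory Submission
  imports Defs
begin

text \<open>
  Both cycles can be traversed starting along the common path \<open>p\<close>, as \<open>p @ r\<close> and \<open>p @ r'\<close>.
  Since they share nothing but \<open>p\<close>, following \<open>r\<close> and then \<open>r'\<close> backwards is again a cycle,
  of length \<open>n + n' - 2 * t\<close>. This length must be 0 or 1 modulo 4, which fixes the parity of \<open>t\<close>.
\<close>

section \<open>Closed walks as lists of arcs\<close>

lemma pcas_append_iff:
  "pcas u (p @ q) w \<longleftrightarrow> (\<exists>v. pcas u p v \<and> pcas v q w)"
  by (induction p arbitrary: u) auto

lemma pcas_rev_swap:
  "pcas u p v \<Longrightarrow> pcas v (map prod.swap (rev p)) u"
  by (induction p arbitrary: u) (auto simp: pcas_append_iff)

text \<open>Both sides list the nodes of the walk with multiplicity: the tails followed by the end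
  node, and the start node followed by the heads.\<close>

lemma pcas_mset:
  "pcas u p v \<Longrightarrow> add_mset v (mset (map fst p)) = add_mset u (mset (map snd p))"
  by (induction p arbitrary: u) (auto simp: add_mset_commute)

lemma pcas_closed_distinct_fst:
  assumes "pcas u p u"
  shows "distinct (map fst p) \<longleftrightarrow> distinct (map snd p)"
  using pcas_mset[OF assms] mset_eq_imp_distinct_iff[of "map fst p" "map snd p"] by simp

text \<open>The host graph is left out, so that cycles can be rotated, reversed and spliced as mere
  lists; lying in \<open>G\<close> becomes the separate condition
  \<open>set p \<subseteq> parcs G\<close>.\<close>

definition cycle_walk :: "'a \<Rightarrow> ('a \<times> 'a) list \<Rightarrow> bool" where
  "cycle_walk u p \<longleftrightarrow> pcas u p u \<and> distinct (map snd p) \<and> 3 \<le> length p"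

lemma cycle_walk_distinct_fst: "cycle_walk u p \<Longrightarrow> distinct (map fst p)"
  by (auto simp: cycle_walk_def dest: pcas_closed_distinct_fst)

lemma pverts_walk_graph: "pcas u p v \<Longrightarrow> pverts (walk_graph u p) = insert u (snd ` set p)"
  by (simp add: walk_graph_def pawalk_verts_eq)

lemma parcs_walk_graph: "parcs (walk_graph u p) = set p \<union> (set p)\<inverse>"
  by (simp add: walk_graph_def)

lemma pcas_closed_pverts:
  assumes "pcas u p u" "p \<noteq> []"
  shows "pverts (walk_graph u p) = snd ` set p"
    and "fst ` set p = snd ` set p"
proof -
  have "u \<in> snd ` set p"
    using pcas_last[OF assms] last_in_set[OF assms(2)] by force
  then show "pverts (walk_graph u p) = snd ` set p"
    using assms(1) by (auto simp: pverts_walk_graph)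
  have "mset (map fst p) = mset (map snd p)" using pcas_mset[OF assms(1)] by simp
  then show "fst ` set p = snd ` set p" by (metis image_set set_mset_mset)
qed

lemma cycle_subgraph_iff:
  assumes "pair_graph G"
  shows "cycle_subgraph G n C \<longleftrightarrow>
    (\<exists>u p. cycle_walk u p \<and> set p \<subseteq> parcs G \<and> length p = n \<and> C = walk_graph u p)"
    (is "?L \<longleftrightarrow> ?R")
proof
  assume ?L
  then obtain u p where "pcas u p u" "set p \<subseteq> parcs G" "pre_digraph.cycle (with_proj G) p"
    "length p = n" "3 \<le> n" "C = walk_graph u p"
    by (auto simp: cycle_subgraph_def pre_digraph.awalk_def cas_with_proj_eq)
  moreover from this have "distinct (map snd p)"
    by (auto simp: pre_digraph.cycle_def pre_digraph.awalk_def cas_with_proj_eq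
        awalk_verts_with_proj_eq pawalk_verts_eq)
  ultimately show ?R unfolding cycle_walk_def by blast
next
  interpret pair_graph G by fact
  assume ?R
  then obtain u p where p: "cycle_walk u p" "set p \<subseteq> parcs G" "length p = n" "C = walk_graph u p"
    by blast
  then have c: "pcas u p u" "distinct (map snd p)" "3 \<le> length p"
    by (auto simp: cycle_walk_def)
  then have "p \<noteq> []" "fst (hd p) = u" by (cases p; auto)+
  then have "u \<in> pverts G" using p(2) hd_in_set[of p]
    by (metis in_arcsD1 prod.collapse subsetD)
  then have "pre_digraph.awalk (with_proj G) u p u"
    using c p by (auto simp: pre_digraph.awalk_def cas_with_proj_eq)
  moreover from this have "pre_digraph.cycle (with_proj G) p"
    using c \<open>p \<noteq> []\<close>
    by (auto simp: pre_digraph.cycle_def awalk_verts_with_proj_eq pawalk_verts_eq)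
  ultimately show ?L using p c unfolding cycle_subgraph_def by blast
qed

text \<open>Every node of a nonempty closed walk is the tail of one of its arcs, so the symmetrised
  arc set determines the nodes as well.\<close>

lemma walk_graph_closed_eqI:
  assumes "pcas u p u" "pcas v q v" "p \<noteq> []" "set p \<union> (set p)\<inverse> = set q \<union> (set q)\<inverse>"
  shows "walk_graph u p = walk_graph v q"
proof -
  have "q \<noteq> []" using assms by auto
  have verts: "pverts (walk_graph w s) = Domain (parcs (walk_graph w s))"
    if "pcas w s w" "s \<noteq> []" for w :: 'a and s
  proof -
    have "Domain (parcs (walk_graph w s)) = fst ` set s \<union> snd ` set s"
      by (simp add: parcs_walk_graph Domain_Un_eq fst_eq_Domain snd_eq_Range)
    then show ?thesis using pcas_closed_pverts[OF that] by auto
  qed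
  show ?thesis
    using verts[OF assms(1,3)] verts[OF assms(2) \<open>q \<noteq> []\<close>] assms(4)
    by (intro pair_pre_digraph.equality) (auto simp: parcs_walk_graph)
qed

section \<open>Re-rooting cycles and cutting out a common path\<close>

lemma cycle_walk_rotate_to_arc:
  assumes "cycle_walk u p" "e \<in> set p"
  obtains q where "cycle_walk (fst e) (e # q)" "mset (e # q) = mset p"
proof -
  obtain a b where p: "p = a @ e # b" using assms(2) by (auto simp: in_set_conv_decomp)
  have "cycle_walk (fst e) (e # b @ a)"
    using assms(1) by (auto simp: cycle_walk_def p pcas_append_iff)
  with that show ?thesis by (simp add: p)
qed

text \<open>Once the cycle is rotated to start with \<open>(a, b)\<close>, the reversed arc splits
  the rest into closed walks at \<open>b\<close> and at \<open>a\<close>. Distinct heads force both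
  to be empty, which leaves only two arcs.\<close>

lemma cycle_walk_no_reversed_arc:
  assumes "cycle_walk u p" "(a, b) \<in> set p"
  shows "(b, a) \<notin> set p"
proof
  assume "(b, a) \<in> set p"
  obtain q where q: "cycle_walk a ((a, b) # q)" "mset ((a, b) # q) = mset p"
    using cycle_walk_rotate_to_arc[OF assms] by auto
  have dist: "distinct (b # map snd q)" and cas: "pcas b q a" and len: "2 \<le> length q"
    using q(1) by (auto simp: cycle_walk_def)
  have "a \<noteq> b"
    \<comment> \<open>If \<open>a = b\<close>, the last arc of \<open>q\<close> would enter the head
      of the first arc again. So the reversed arc differs from the first arc and must lie in
      \<open>q\<close>.\<close>
    using cas dist len pcas_last[OF cas] last_in_set[of q] by (cases "q = []") force+
  moreover have "(b, a) \<in> set ((a, b) # q)"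
    using \<open>(b, a) \<in> set p\<close> q(2) by (metis set_mset_mset)
  ultimately obtain q1 q2 where q12: "q = q1 @ (b, a) # q2"
    by (auto simp: in_set_conv_decomp)
  have cas12: "pcas b q1 b" "pcas a q2 a" using cas by (auto simp: q12 pcas_append_iff)
  have "q1 = []"
    using pcas_last[OF cas12(1)] dist last_in_set[of q1] by (cases "q1 = []") (force simp: q12)+
  moreover have "q2 = []"
    using pcas_last[OF cas12(2)] dist last_in_set[of q2] by (cases "q2 = []") (force simp: q12)+
  ultimately show False using len by (simp add: q12)
qed

lemma cycle_walk_rev:
  assumes "cycle_walk u p"
  shows "cycle_walk u (map prod.swap (rev p))"
  using assms cycle_walk_distinct_fst[OF assms] pcas_rev_swap
  by (auto simp: cycle_walk_def rev_map[symmetric] o_def)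

text \<open>If \<open>e\<close> is only traversed against its direction, the walk is reversed first;
  then it is rotated. This lets two cycles be oriented alike along a common arc.\<close>

lemma cycle_walk_starting_with_arc:
  assumes "cycle_walk u p" "e \<in> parcs (walk_graph u p)"
  obtains q where "cycle_walk (fst e) (e # q)" "length (e # q) = length p"
    "walk_graph (fst e) (e # q) = walk_graph u p"
proof -
  obtain p' where p': "cycle_walk u p'" "e \<in> set p'" "length p' = length p"
    "set p' \<union> (set p')\<inverse> = set p \<union> (set p)\<inverse>"
  proof (cases "e \<in> set p")
    case True
    then show ?thesis using that assms by blast
  next
    case False
    then have "prod.swap e \<in> set p" using assms by (cases e) (auto simp: parcs_walk_graph)
    then have "e \<in> set (map prod.swap (rev p))" by force
    moreover have "set (map prod.swap (rev p)) = (set p)\<inverse>" by force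
    ultimately show ?thesis
      using that[OF cycle_walk_rev[OF assms(1)]] by (simp add: Un_commute)
  qed
  obtain q where q: "cycle_walk (fst e) (e # q)" "mset (e # q) = mset p'"
    using cycle_walk_rotate_to_arc[OF p'(1,2)] by metis
  have s: "set (e # q) = set p'" "length (e # q) = length p'"
    using arg_cong[OF q(2), of set_mset] arg_cong[OF q(2), of size] by simp_all
  have "walk_graph (fst e) (e # q) = walk_graph u p"
    using q(1) assms(1) p'(4) s(1)
    by (intro walk_graph_closed_eqI) (auto simp: cycle_walk_def)
  with that q s p' show ?thesis by simp
qed

text \<open>Agreement in the first arc fixes the direction of travel. From then on the path cannot
  turn back, and a tail determines the arc of the cycle leaving it, so path and cycle proceed
  together.\<close>

lemma path_prefix_of_cycle_walk:
  assumes "cycle_walk x q" "pcas x p y" "p \<noteq> []" "hd p = hd q" "distinct (x # map snd p)"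
    "set p \<subseteq> set q \<union> (set q)\<inverse>"
  shows "\<exists>r. r \<noteq> [] \<and> q = p @ r"
  using assms(2-)
proof (induction p arbitrary: y rule: rev_induct)
  case Nil
  then show ?case by simp
next
  case (snoc e p)
  have q: "pcas x q x" "distinct (map snd q)" "3 \<le> length q"
    using assms(1) by (auto simp: cycle_walk_def)
  have dfst: "distinct (map fst q)" using cycle_walk_distinct_fst assms(1) .
  obtain z where z: "pcas x p z" and e: "e = (z, y)"
    using snoc.prems(1) by (cases e) (auto simp: pcas_append_iff)
  show ?case
  proof (cases "p = []")
    case True
    then show ?thesis using snoc.prems(3) q(3) by (cases q; cases "tl q") auto
  next
    case False
    have "\<exists>r. r \<noteq> [] \<and> q = p @ r"
      using snoc.IH[OF z False] snoc.prems False by simp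
    then obtain f r where r: "q = p @ f # r" by (metis neq_Nil_conv)
    have f: "fst f = z" "pcas (snd f) r x"
    proof -
      obtain z' where "pcas x p z'" "pcas z' (f # r) x"
        using q(1) by (auto simp: r pcas_append_iff)
      moreover have "z' = z" using pcas_last[OF z False] pcas_last[OF \<open>pcas x p z'\<close> False] by simp
      ultimately show "fst f = z" "pcas (snd f) r x" by auto
    qed
    \<comment> \<open>Otherwise the cycle contains \<open>e\<close> reversed. Since only one arc of
      the cycle enters \<open>z\<close>, that arc is \<open>last p\<close>, so the path has already
      visited \<open>y\<close>.\<close>
    have "e \<in> set q"
    proof (rule ccontr)
      assume "e \<notin> set q"
      then have yz: "(y, z) \<in> set q" using snoc.prems(5) e by auto
      have "last p \<in> set q" "snd (last p) = z"
        using False pcas_last[OF z False] by (auto simp: r)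
      then have "last p = (y, z)"
        using yz q(2) inj_onD[of snd "set q" "last p" "(y, z)"] by (simp add: distinct_map)
      then have "p = butlast p @ [(y, z)]" using False by (metis append_butlast_last_id)
      then have "pcas x (butlast p @ [(y, z)]) z" using z by simp
      then have "pcas x (butlast p) y" by (auto simp: pcas_append_iff)
      then have "y \<in> set (x # map snd (butlast p))"
        using pcas_last[of x "butlast p" y] last_in_set[of "butlast p"]
        by (cases "butlast p = []") force+
      then have "y \<in> set (x # map snd p)" by (auto dest: in_set_butlastD)
      then show False using snoc.prems(4) e by auto
    qed
    then have "e = f" using dfst f(1) e inj_onD[of fst "set q" e f]
      by (simp add: distinct_map) (simp add: r)
    \<comment> \<open>With nothing left over, the cycle would close with \<open>e\<close>, giving
      \<open>y = x\<close> on a path.\<close>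
    moreover have "r \<noteq> []" using f(2) \<open>e = f\<close> snoc.prems(4) e by auto
    ultimately show ?thesis by (auto simp: r)
  qed
qed

text \<open>Both \<open>r\<close> and \<open>r'\<close> lead from the end of \<open>p\<close> back
  to \<open>x\<close>. Reversal turns tails into heads, so the main point is that no head of
  \<open>r\<close> is a tail of \<open>r'\<close>. Such a node would be \<open>x\<close> or a head
  of \<open>p\<close>; heads of \<open>p\<close> are not heads of \<open>r\<close>, and
  \<open>x\<close> is already the tail of the first arc of \<open>p\<close>.\<close>

lemma cycle_walk_symmetric_difference:
  assumes c: "cycle_walk x (p @ r)" "cycle_walk x (p @ r')"
    and ne: "p \<noteq> []" "r \<noteq> []" "r' \<noteq> []"
    and verts: "snd ` set (p @ r) \<inter> snd ` set (p @ r') \<subseteq> insert x (snd ` set p)"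
    and arcs: "set r \<inter> set r' = {}"
  obtains y where "cycle_walk y (r @ map prod.swap (rev r'))"
proof -
  note c1 = c[unfolded cycle_walk_def]
  have dfst: "distinct (map fst (p @ r'))" by (rule cycle_walk_distinct_fst[OF c(2)])
  obtain y where y: "pcas x p y" "pcas y r x"
    using c1 by (auto simp: pcas_append_iff)
  obtain y' where y': "pcas x p y'" "pcas y' r' x"
    using c1 by (auto simp: pcas_append_iff)
  have "y' = y" using y(1) y'(1) pcas_last ne(1) by metis
  then have r': "pcas y r' x" using y' by simp
  have closed: "pcas y (r @ map prod.swap (rev r')) y"
    using y(2) pcas_rev_swap[OF r'] by (auto simp: pcas_append_iff)
  have "snd ` set r \<inter> fst ` set r' = {}"
  proof (rule ccontr)
    assume "snd ` set r \<inter> fst ` set r' \<noteq> {}"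
    then obtain v where v: "v \<in> snd ` set r" "v \<in> fst ` set r'" by blast
    have "fst ` set (p @ r') = snd ` set (p @ r')"
      using pcas_closed_pverts(2)[of x "p @ r'"] c1(2) ne by simp
    then have "v \<in> snd ` set (p @ r')" using v(2) by auto
    then have "v \<in> insert x (snd ` set p)" using verts v(1) by auto
    moreover have "v \<notin> snd ` set p" using v(1) c1(1) by auto
    moreover have "x \<in> fst ` set p" using y(1) ne(1) by (cases p) auto
    ultimately show False using v(2) dfst by auto
  qed
  moreover have "distinct (map snd r)" "distinct (map fst r')" using c1 dfst by auto
  ultimately have "distinct (map snd (r @ map prod.swap (rev r')))"
    by (auto simp: rev_map[symmetric] o_def)
  \<comment> \<open>A shorter closed walk would consist of two single arcs, both equal to
    \<open>(y, x)\<close> before reversal.\<close>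
  moreover have "3 \<le> length (r @ map prod.swap (rev r'))"
  proof (rule ccontr)
    assume "\<not> ?thesis"
    moreover have "length r > 0" "length r' > 0" using ne by auto
    ultimately have "length r = 1 \<and> length r' = 1" 
      unfolding length_append length_map length_rev by linarith
    then have "length r = 1" "length r' = 1" by auto
    then have "r = [(y, x)]" "r' = [(y, x)]"
      using y(2) r' by (auto simp: length_Suc_conv)
    then show False using arcs by simp
  qed
  ultimately show ?thesis using that closed unfolding cycle_walk_def by blast
qed

section \<open>Cycle lengths modulo 4\<close>

lemma double_add_mod_4:
  fixes t s :: nat
  shows "(2 * t + s) mod 4 = (if even t then s mod 4 else (2 + s mod 4) mod 4)"
proof (cases "even t")
  case True
  then obtain k where "t = 2 * k" by blast
  then have "2 * t + s = s + 4 * k" by simp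
  then show ?thesis using True by (simp only: mod_mult_self2 if_True)
next
  case False
  then obtain k where "t = 2 * k + 1" by (blast elim: oddE)
  then have "2 * t + s = 2 + s + 4 * k" by simp
  then show ?thesis using False by (simp only: mod_mult_self2 if_False mod_add_right_eq)
qed

theorem theorem3:
  fixes G C C' :: "'a pair_pre_digraph" and t :: nat
  assumes "G \<in> euler01"
    and "\<exists>n. cycle_subgraph G n C"
    and "\<exists>n. cycle_subgraph G n C'"
    and "path_subgraph G t (graph_inter C C')"
    and "t > 0"
  shows "((cycle_of_type G 0 C \<and> cycle_of_type G 0 C') \<or>
          (cycle_of_type G 0 C \<and> cycle_of_type G 1 C') \<or>
          (cycle_of_type G 1 C \<and> cycle_of_type G 0 C') \<longrightarrow> even t) \<and>
         (cycle_of_type G 1 C \<and> cycle_of_type G 1 C' \<longrightarrow> odd t)"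
proof -
  have G: "pair_graph G"
    and types: "\<And>n D. cycle_subgraph G n D \<Longrightarrow> [n = 0] (mod 4) \<or> [n = 1] (mod 4)"
    using assms(1) by (auto simp: euler01_def euler_graph_def)
  interpret pair_graph G by (rule G)
  obtain n n' where n: "cycle_subgraph G n C" "cycle_subgraph G n' C'"
    using assms(2,3) by blast
  obtain u q where q: "cycle_walk u q" "set q \<subseteq> parcs G" "length q = n" "C = walk_graph u q"
    using n(1) cycle_subgraph_iff[OF G] by blast
  obtain u' q' where q': "cycle_walk u' q'" "set q' \<subseteq> parcs G" "length q' = n'"
      "C' = walk_graph u' q'"
    using n(2) cycle_subgraph_iff[OF G] by blast
  obtain x p y where p: "pcas x p y" "distinct (pawalk_verts x p)" "length p = t"
      and inter: "graph_inter C C' = walk_graph x p"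
    using assms(4)
    by (auto simp: path_subgraph_def pre_digraph.apath_def pre_digraph.awalk_def
        cas_with_proj_eq awalk_verts_with_proj_eq)
  have dp: "distinct (x # map snd p)" using p(1,2) by (simp add: pawalk_verts_eq)
  obtain e p0 where e: "p = e # p0" using p(3) assms(5) by (cases p) auto
  have x: "fst e = x" using p(1) e by auto
  have arcs: "parcs C \<inter> parcs C' = set p \<union> (set p)\<inverse>"
    using inter by (metis graph_inter_def pair_pre_digraph.select_convs(2) parcs_walk_graph)
  have verts: "pverts C \<inter> pverts C' = insert x (snd ` set p)"
    using inter p(1)
    by (metis graph_inter_def pair_pre_digraph.select_convs(1) pverts_walk_graph)
  \<comment> \<open>Stated for an arbitrary cycle containing the path, so that it serves both
    \<open>C\<close> and \<open>C'\<close>, orienting each along \<open>p\<close>.\<close>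
  have prefix: "\<exists>r. r \<noteq> [] \<and> cycle_walk x (p @ r) \<and> length (p @ r) = length s
      \<and> walk_graph x (p @ r) = walk_graph w s"
    if s: "cycle_walk w s" "set p \<subseteq> parcs (walk_graph w s)" for w s
  proof -
    obtain s' where s': "cycle_walk x (e # s')" "length (e # s') = length s"
      "walk_graph x (e # s') = walk_graph w s"
      using cycle_walk_starting_with_arc[OF s(1), of e] s(2) e x by auto
    have "set p \<subseteq> set (e # s') \<union> (set (e # s'))\<inverse>"
      using s(2) s'(3) parcs_walk_graph by metis
    then obtain r where "r \<noteq> []" "e # s' = p @ r"
      using path_prefix_of_cycle_walk[OF s'(1) p(1) _ _ dp] e by auto
    with s' show ?thesis by metis
  qed
  obtain r where r: "r \<noteq> []" "cycle_walk x (p @ r)" "length (p @ r) = n"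
      "C = walk_graph x (p @ r)"
    using prefix[OF q(1)] arcs unfolding q(3,4)[symmetric]
    by (metis Int_subset_iff Un_subset_iff order_refl)
  obtain r' where r': "r' \<noteq> []" "cycle_walk x (p @ r')" "length (p @ r') = n'"
      "C' = walk_graph x (p @ r')"
    using prefix[OF q'(1)] arcs unfolding q'(3,4)[symmetric]
    by (metis Int_subset_iff Un_subset_iff order_refl)
  have vC: "pverts C = snd ` set (p @ r)" "pverts C' = snd ` set (p @ r')"
    using r r' by (auto simp: cycle_walk_def pcas_closed_pverts(1))
  \<comment> \<open>A shared arc would belong to the common path in one of its directions. Forwards
    it would repeat an arc of \<open>p @ r\<close>; backwards it would make that cycle use an edge
    both ways.\<close>
  have disj: "set r \<inter> set r' = {}"
  proof (rule ccontr)
    assume "set r \<inter> set r' \<noteq> {}"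
    then obtain a b where ab: "(a, b) \<in> set r" "(a, b) \<in> set r'" by auto
    then have "(a, b) \<in> parcs C \<inter> parcs C'" by (simp add: r(4) r'(4) parcs_walk_graph)
    moreover have dr: "distinct (map snd (p @ r))" "distinct (map fst (p @ r))"
      using r(2) cycle_walk_distinct_fst[OF r(2)] by (simp_all add: cycle_walk_def)
    then have "(a, b) \<notin> set p" using ab by auto
    ultimately have "(b, a) \<in> set p" using arcs by auto
    then show False using cycle_walk_no_reversed_arc[OF r(2), of a b] ab(1) by simp
  qed
  have "p \<noteq> []" using e by simp
  moreover have "snd ` set (p @ r) \<inter> snd ` set (p @ r') \<subseteq> insert x (snd ` set p)"
    using verts unfolding vC by simp
  ultimately obtain z where z: "cycle_walk z (r @ map prod.swap (rev r'))"
    using cycle_walk_symmetric_difference[OF r(2) r'(2) _ r(1) r'(1) _ disj] by metis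
  \<comment> \<open>Symmetry of the arcs of \<open>G\<close> matters here, since the new cycle
    traverses \<open>r'\<close> backwards.\<close>
  have sub: "parcs C \<subseteq> parcs G" "parcs C' \<subseteq> parcs G"
    using q q' arcs_symmetric by (auto simp: parcs_walk_graph)
  have "set (r @ map prod.swap (rev r')) \<subseteq> parcs G"
    using sub by (auto simp: r(4) r'(4) parcs_walk_graph)
  then have "cycle_subgraph G (length r + length r') (walk_graph z (r @ map prod.swap (rev r')))"
    unfolding cycle_subgraph_iff[OF G]
    by (intro exI[of _ z] exI[of _ "r @ map prod.swap (rev r')"]) (simp add: z)
  then have "[length r + length r' = 0] (mod 4) \<or> [length r + length r' = 1] (mod 4)"
    by (rule types)
  then have len: "(length r + length r') mod 4 = 0 \<or> (length r + length r') mod 4 = 1"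
    by (simp add: cong_def)
  have nn: "n = t + length r" "n' = t + length r'" using r(3) r'(3) p(3) by auto
  \<comment> \<open>A type speaks of some length of the cycle; as the length equals the number of
    nodes, it must be \<open>n\<close>.\<close>
  have type: "[n = i] (mod 4)" if "cycle_of_type G i C" for i
    using that n(1) cycle_subgraph_card unfolding cycle_of_type_def by metis
  have type': "[n' = i] (mod 4)" if "cycle_of_type G i C'" for i
    using that n(2) cycle_subgraph_card unfolding cycle_of_type_def by metis
  have sum: "n + n' = 2 * t + (length r + length r')" using nn by simp
  have key: "(n mod 4 + n' mod 4) mod 4 = (if even t then (length r + length r') mod 4
      else (2 + (length r + length r') mod 4) mod 4)"
    unfolding mod_add_eq sum by (rule double_add_mod_4)
  \<comment> \<open>For odd \<open>t\<close> the new cycle's residue 0 or 1 is shifted by 2, so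
    \<open>n + n'\<close> would be 2 or 3 modulo 4.\<close>
  have "even t" if "n mod 4 + n' mod 4 = 0 \<or> n mod 4 + n' mod 4 = 1"
  proof (rule ccontr)
    assume "odd t"
    then have "(n mod 4 + n' mod 4) mod 4 = (2 + (length r + length r') mod 4) mod 4"
      using key by (simp only: if_False)
    then show False using that len by (elim disjE) simp_all
  qed
  \<comment> \<open>Here \<open>n + n'\<close> is 2 modulo 4, and an even \<open>t\<close> would
    pass this forbidden residue on to the new cycle.\<close>
  moreover have "odd t" if "n mod 4 = 1" "n' mod 4 = 1"
  proof
    assume "even t"
    then have "(length r + length r') mod 4 = 2" using key that by simp
    then show False using len by simp
  qed
  ultimately show ?thesis using type type' by (auto simp: cong_def)
qed

end
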